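(* Let $A=(\Sigma,Q,\delta,I)$ be a top-down tree automaton and let $R\subseteq Q\times Q$ be a strict partial order with $R\subset{\subseteq^{\mathsf{up}}(\mathrm{id})}$, where $\subseteq^{\mathsf{up}}(\mathrm{id})$ is the upward trace inclusion preorder on $A$ induced by the identity. Then $P(R,\mathrm{id})$ is good for pruning, i.e. $L(\mathrm{Prune}(A,P(R,\mathrm{id})))=L(A)$.
   Context: **Trees.** A ranked alphabet $\Sigma$ is a set of symbols with a rank function $\#:\Sigma\to\mathbb N_0$. Nodes are finite sequences of positive integers; $\varepsilon$ is the empty sequence. A tree over $\Sigma$ is a partial map $t$ from nodes to $\Sigma$ with finite nonempty domain such that if $vi\in\mathrm{dom}(t)$ ($i\ge1$) then $v\in\mathrm{dom}(t)$ and $i\le\#(t(v))$ (some children may be missing). A tree is closed if every $v\in\mathrm{dom}(t)$ has exactly $\#(t(v))$ children in $\mathrm{dom}(t)$. **Automata.** A top-down tree automaton (TDTA) is $A=(\Sigma,Q,\delta,I)$ with $Q$ a finite set of states, $I\subseteq Q$ the initial states, a unique final state $\psi\in Q$ which has no outgoing transitions, and $\delta\subseteq Q\times\Sigma\times Q^+$ a set of transitions, each of the form $\langle q,a,\psi\rangle$ with $\#(a)=0$ or $\langle q,a,q_1\dots q_n\rangle$ with $n=\#(a)\ge1$. A run of $A$ on a tree $t$ (a $t$-run) is a map $\pi$ to $Q$ with domain $\mathrm{dom}(t)\cup\{vi: v\in\mathrm{dom}(t),1\le i\le\#(t(v))\}$ such that for every $v\in\mathrm{dom}(t)$: if $\#(t(v))=0$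 then $\langle\pi(v),t(v),\psi\rangle\in\delta$, and if $n=\#(t(v))\ge1$ then $\langle\pi(v),t(v),\pi(v1)\dots\pi(vn)\rangle\in\delta$. A dangling leaf of $\pi$ is a node in $\mathrm{dom}(\pi)\setminus\mathrm{dom}(t)$. The language $L(A)$ is the set of closed trees $t$ having a $t$-run $\pi$ with $\pi(\varepsilon)\in I$. **Upward trace inclusion.** For a relation $S$ on $Q$, $q\subseteq^{\mathsf{up}}(S)\,r$ iff ($q=\psi\Rightarrow r=\psi$), ($q\in I\Rightarrow r\in I$), and for every tree $t$, every $t$-run $\pi_q$ and every dangling leaf $v$ of $\pi_q$ with $\pi_q(v)=q$ there is a $t$-run $\pi_r$ such that (1) $\pi_r(v)=r$; (2) for all prefixes $v'$ of $v$, $\pi_q(v')\in I\Rightarrow\pi_r(v')\in I$; (3) whenever $v'$ is a strict prefix of $v$ and $v'x\in\mathrm{dom}(\pi_q)$ ($x\ge1$ an integer) is not a prefix of $v$, then $\pi_q(v'x)\,S\,\pi_r(v'x)$. Here $S=\mathrm{id}$ is the identity relation on $Q$. **Pruning.** $P(R,\mathrm{id})$ is the set of pairs of transitions $(\langle p,\sigma,r_1\dots r_n\rangle,\langle p',\sigma,r'_1\dots r'_n\rangle)\in\delta\times\delta$ with $p\,R\,p'$ and $r_i=r'_i$ for all $i$. For a strict partial order $P$ on $\delta$, $\mathrm{Prune}(A,P)=(\Sigma,Q,\delta',I)$ where $\delta'$ is the set of $\tau\in\delta$ for which there is no $\tau'\in\delta$ with $\tau\,P\,\tau'$. $P$ is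 good for pruning (GFP) iff $L(\mathrm{Prune}(A,P))=L(A)$. *)

theory Defs
  imports Main "HOL-Library.Sublist"
begin

type_synonym node = "nat list"

(* The child number i of node v is v @ [i]. *)
definition is_node :: "node \<Rightarrow> bool" where
  "is_node v \<longleftrightarrow> (\<forall>i \<in> set v. i \<ge> 1)"

(* A tree is a partial map; children below the rank may be missing. *)
type_synonym 'a tree = "node \<Rightarrow> 'a option"

definition is_tree :: "'a set \<Rightarrow> ('a \<Rightarrow> nat) \<Rightarrow> 'a tree \<Rightarrow> bool" where
  "is_tree \<Sigma> rk t \<longleftrightarrow>
     finite (dom t) \<and> dom t \<noteq> {} \<and>
     (\<forall>v \<in> dom t. is_node v) \<and> ran t \<subseteq> \<Sigma> \<and>
     (\<forall>v i. v @ [i] \<in> dom t \<longrightarrow> v \<in> dom t \<and> i \<le> rk (the (t v)))"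

definition closed_tree :: "('a \<Rightarrow> nat) \<Rightarrow> 'a tree \<Rightarrow> bool" where
  "closed_tree rk t \<longleftrightarrow> (\<forall>v \<in> dom t. card {i. v @ [i] \<in> dom t} = rk (the (t v)))"

(* Only the values of rank on the alphabet matter. *)
record ('q, 'a) automaton =
  alphabet :: "'a set"
  rank     :: "'a \<Rightarrow> nat"
  states   :: "'q set"
  delta    :: "('q \<times> 'a \<times> 'q list) set"
  initial  :: "'q set"
  final    :: 'q

definition tdta :: "('q, 'a) automaton \<Rightarrow> bool" where
  "tdta A \<longleftrightarrow>
     finite (states A) \<and> initial A \<subseteq> states A \<and> final A \<in> states A \<and>
     (\<forall>(q, a, qs) \<in> delta A.
        q \<in> states A \<and> q \<noteq> final A \<and> a \<in> alphabet A \<and> set qs \<subseteq> states A \<and>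
        (if rank A a = 0 then qs = [final A] else length qs = rank A a))"

definition is_run :: "('q, 'a) automaton \<Rightarrow> 'a tree \<Rightarrow> (node \<Rightarrow> 'q option) \<Rightarrow> bool" where
  "is_run A t \<pi> \<longleftrightarrow>
     dom \<pi> = dom t \<union> {v @ [i] | v i. v \<in> dom t \<and> 1 \<le> i \<and> i \<le> rank A (the (t v))} \<and>
     ran \<pi> \<subseteq> states A \<and>
     (\<forall>v \<in> dom t.
        let a = the (t v); n = rank A a in
        if n = 0 then (the (\<pi> v), a, [final A]) \<in> delta A
        else (the (\<pi> v), a, map (\<lambda>i. the (\<pi> (v @ [i]))) [1..<n + 1]) \<in> delta A)"

definition dangling_leaves :: "'a tree \<Rightarrow> (node \<Rightarrow> 'q option) \<Rightarrow> node set" where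
  "dangling_leaves t \<pi> = dom \<pi> - dom t"

definition language :: "('q, 'a) automaton \<Rightarrow> 'a tree set" where
  "language A =
     {t. is_tree (alphabet A) (rank A) t \<and> closed_tree (rank A) t \<and>
         (\<exists>\<pi>. is_run A t \<pi> \<and> the (\<pi> []) \<in> initial A)}"

(* prefix is reflexive, so the second condition on runs includes v itself. *)
definition up_trace_incl :: "('q, 'a) automaton \<Rightarrow> 'q rel \<Rightarrow> 'q rel" where
  "up_trace_incl A S =
     {(q, r). q \<in> states A \<and> r \<in> states A \<and>
        (q = final A \<longrightarrow> r = final A) \<and>
        (q \<in> initial A \<longrightarrow> r \<in> initial A) \<and>
        (\<forall>t \<pi>\<^sub>q v.
           is_tree (alphabet A) (rank A) t \<and> is_run A t \<pi>\<^sub>q \<and>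
           v \<in> dangling_leaves t \<pi>\<^sub>q \<and> \<pi>\<^sub>q v = Some q \<longrightarrow>
           (\<exists>\<pi>\<^sub>r. is_run A t \<pi>\<^sub>r \<and> \<pi>\<^sub>r v = Some r \<and>
              (\<forall>v'. prefix v' v \<longrightarrow>
                 the (\<pi>\<^sub>q v') \<in> initial A \<longrightarrow> the (\<pi>\<^sub>r v') \<in> initial A) \<and>
              (\<forall>v' x. strict_prefix v' v \<and> v' @ [x] \<in> dom \<pi>\<^sub>q \<and> \<not> prefix (v' @ [x]) v \<longrightarrow>
                 (the (\<pi>\<^sub>q (v' @ [x])), the (\<pi>\<^sub>r (v' @ [x]))) \<in> S)))}"

definition strict_partial_order_on :: "'b set \<Rightarrow> 'b rel \<Rightarrow> bool" where
  "strict_partial_order_on X r \<longleftrightarrow> r \<subseteq> X \<times> X \<and> irrefl_on X r \<and> trans_on X r"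

(* The relation P(R, id) on transitions. *)
definition prune_rel_id ::
  "('q, 'a) automaton \<Rightarrow> 'q rel \<Rightarrow> ('q \<times> 'a \<times> 'q list) rel" where
  "prune_rel_id A R =
     {((p, a, rs), (p', a', rs')).
        (p, a, rs) \<in> delta A \<and> (p', a', rs') \<in> delta A \<and>
        a = a' \<and> (p, p') \<in> R \<and> rs = rs'}"

definition Prune ::
  "('q, 'a) automaton \<Rightarrow> ('q \<times> 'a \<times> 'q list) rel \<Rightarrow> ('q, 'a) automaton" where
  "Prune A P = A\<lparr>delta := {\<tau> \<in> delta A. \<not> (\<exists>\<tau>' \<in> delta A. (\<tau>, \<tau>') \<in> P)}\<rparr>"

(* Meant for strict partial orders P on delta A; prune_rel_id yields one, see below. *)
definition good_for_pruning ::
  "('q, 'a) automaton \<Rightarrow> ('q \<times> 'a \<times> 'q list) rel \<Rightarrow> bool" where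
  "good_for_pruning A P \<longleftrightarrow> language (Prune A P) = language A"

lemma strict_partial_order_on_prune_rel_id:
  assumes "strict_partial_order_on (states A) R"
  shows "strict_partial_order_on (delta A) (prune_rel_id A R)"
proof -
  have irr: "(p, p) \<notin> R" for p
    using assms by (auto simp: strict_partial_order_on_def irrefl_on_def)
  have tr: "(p, r) \<in> R" if "(p, q) \<in> R" "(q, r) \<in> R" for p q r
    using assms that unfolding strict_partial_order_on_def trans_on_def by blast
  show ?thesis
    unfolding strict_partial_order_on_def irrefl_on_def trans_on_def prune_rel_id_def
    using irr by (auto intro: tr)
qed

end

theory Submission
  imports Defs
begin

text \<open>Suppose an accepting run uses at a node \<open>v\<close> a transition that is pruned in favour of one with
  a larger source state and the same targets. Upward trace inclusion, applied to the tree with the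
  subtree at \<open>v\<close> cut off, yields a run that has the larger state at \<open>v\<close>, differs from the old one
  only along the path from the root to \<open>v\<close>, and is still accepting. So the nodes can be repaired from
  the leaves upwards: a repair at \<open>v\<close> spoils only proper ancestors of \<open>v\<close>, and at a fixed \<open>v\<close> it can be
  iterated only finitely often because the states strictly increase.\<close>

section \<open>Runs as families of local transitions\<close>

text \<open>Collecting the run condition at a node into one transition makes pruning a condition on
  single nodes. A symbol of rank 0 has no child to supply the target, hence the constant
  \<open>[final A]\<close>.\<close>

definition transition_at ::
  "('q, 'a) automaton \<Rightarrow> 'a tree \<Rightarrow> (node \<Rightarrow> 'q option) \<Rightarrow> node \<Rightarrow> 'q \<times> 'a \<times> 'q list" where
  "transition_at A t \<pi> v =
     (let a = the (t v) in
      (the (\<pi> v), a, if rank A a = 0 then [final A]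
                      else map (\<lambda>i. the (\<pi> (v @ [i]))) [1..<rank A a + 1]))"

definition run_domain :: "('q, 'a) automaton \<Rightarrow> 'a tree \<Rightarrow> node set" where
  "run_domain A t = dom t \<union> {v @ [i] | v i. v \<in> dom t \<and> 1 \<le> i \<and> i \<le> rank A (the (t v))}"

lemma is_run_iff:
  "is_run A t \<pi> \<longleftrightarrow> dom \<pi> = run_domain A t \<and> ran \<pi> \<subseteq> states A \<and>
     (\<forall>v \<in> dom t. transition_at A t \<pi> v \<in> delta A)"
  unfolding is_run_def run_domain_def transition_at_def Let_def by (auto split: if_splits)

lemma transition_at_cong:
  assumes "t v = t' v" and "\<pi> v = \<pi>' v"
    and "\<And>i. \<lbrakk>1 \<le> i; i \<le> rank A (the (t v))\<rbrakk> \<Longrightarrow> \<pi> (v @ [i]) = \<pi>' (v @ [i])"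
  shows "transition_at A t \<pi> v = transition_at A t' \<pi>' v"
  using assms by (auto simp: transition_at_def Let_def simp del: upt_Suc)

section \<open>Cutting off a subtree\<close>

lemma is_tree_prefix_closed:
  assumes "is_tree \<Sigma> rk t" and "v \<in> dom t" and "prefix w v"
  shows "w \<in> dom t"
  using assms(2,3)
proof (induction v rule: rev_induct)
  case Nil
  then show ?case by simp
next
  case (snoc i v)
  have "v \<in> dom t"
    using assms(1) snoc.prems(1) unfolding is_tree_def by blast
  with snoc show ?case by (auto simp: prefix_snoc)
qed

text \<open>Children may be missing in a tree, so only nonemptiness is at stake;
  \<open>v \<noteq> []\<close> keeps the root.\<close>

lemma is_tree_cut:
  assumes tree: "is_tree \<Sigma> rk t" and v: "v \<in> dom t" "v \<noteq> []"
  shows "is_tree \<Sigma> rk (t |` {w. \<not> prefix v w})"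
proof -
  have "[] \<in> dom t"
    using is_tree_prefix_closed[OF tree v(1)] by simp
  then have "[] \<in> dom (t |` {w. \<not> prefix v w})"
    using v(2) by auto
  moreover have "u \<in> dom (t |` {w. \<not> prefix v w}) \<and> i \<le> rk (the ((t |` {w. \<not> prefix v w}) u))"
    if "u @ [i] \<in> dom (t |` {w. \<not> prefix v w})" for u i
  proof -
    have "u @ [i] \<in> dom t" and np: "\<not> prefix v u"
      using that by auto
    then have "u \<in> dom t \<and> i \<le> rk (the (t u))"
      using tree unfolding is_tree_def by blast
    with np show ?thesis by auto
  qed
  moreover have "ran (t |` {w. \<not> prefix v w}) \<subseteq> \<Sigma>"
    using tree unfolding is_tree_def by (auto simp: ran_def restrict_map_def split: if_splits)
  moreover have "finite (dom (t |` {w. \<not> prefix v w}))"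
    "\<forall>w \<in> dom (t |` {w. \<not> prefix v w}). is_node w"
    using tree unfolding is_tree_def by auto
  ultimately show ?thesis
    unfolding is_tree_def by (intro conjI) (assumption | blast)+
qed

text \<open>Although \<open>v\<close> leaves the tree, it stays in the domain of runs as a child of
  its surviving parent, hence \<open>strict_prefix\<close> against \<open>prefix\<close>. This makes
  \<open>v\<close> a dangling leaf.\<close>

lemma run_domain_cut:
  assumes tree: "is_tree \<Sigma> (rank A) t" and v: "v \<in> dom t" "v \<noteq> []"
  shows "run_domain A (t |` {w. \<not> prefix v w}) = run_domain A t \<inter> {w. \<not> strict_prefix v w}"
    (is "?L = ?R")
proof
  show "?L \<subseteq> ?R"
    by (fastforce simp: run_domain_def strict_prefix_def)
  show "?R \<subseteq> ?L"
  proof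
    fix w assume w: "w \<in> ?R"
    consider "w \<in> dom t" "w \<noteq> v" | "w = v"
      | u i where "w = u @ [i]" "u \<in> dom t" "1 \<le> i" "i \<le> rank A (the (t u))"
      using w by (auto simp: run_domain_def)
    then show "w \<in> ?L"
    proof cases
      case 1
      with w show ?thesis by (auto simp: run_domain_def strict_prefix_def)
    next
      case 2
      obtain u i where ui: "v = u @ [i]"
        using v(2) by (metis rev_exhaust)
      have "u \<in> dom t" "i \<le> rank A (the (t u))"
        using tree v(1) unfolding is_tree_def ui by blast+
      moreover have "1 \<le> i"
        using tree v(1) unfolding is_tree_def is_node_def ui by force
      moreover have "\<not> prefix v u"
        using ui by (auto dest: prefix_length_le)
      ultimately have "u \<in> dom (t |` {w. \<not> prefix v w}) \<and> 1 \<le> i \<and>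
          i \<le> rank A (the ((t |` {w. \<not> prefix v w}) u))"
        by auto
      then show ?thesis
        unfolding run_domain_def 2 ui by blast
    next
      case 3
      have "\<not> prefix v u"
        using w 3(1) by (auto simp: strict_prefix_def dest: prefix_length_le)
      with 3 have "u \<in> dom (t |` {w. \<not> prefix v w}) \<and> 1 \<le> i \<and>
          i \<le> rank A (the ((t |` {w. \<not> prefix v w}) u))"
        by auto
      then show ?thesis
        unfolding run_domain_def 3(1) by blast
    qed
  qed
qed

text \<open>A surviving node keeps its label, and none of its children lies strictly below
  \<open>v\<close>, so its transition is unchanged.\<close>

lemma is_run_cut:
  assumes tree: "is_tree \<Sigma> (rank A) t" and run: "is_run A t \<pi>" and v: "v \<in> dom t" "v \<noteq> []"
  shows "is_run A (t |` {w. \<not> prefix v w}) (\<pi> |` {w. \<not> strict_prefix v w})"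
    (is "is_run A ?t ?\<pi>")
  unfolding is_run_iff
proof (intro conjI ballI)
  show "dom ?\<pi> = run_domain A ?t"
    using run unfolding run_domain_cut[OF tree v] is_run_iff by simp
  show "ran ?\<pi> \<subseteq> states A"
    using run unfolding is_run_iff by (auto simp: ran_def restrict_map_def split: if_splits)
next
  fix u assume u: "u \<in> dom ?t"
  have "transition_at A ?t ?\<pi> u = transition_at A t \<pi> u"
    using u by (intro transition_at_cong) (auto simp: restrict_map_def strict_prefix_def)
  then show "transition_at A ?t ?\<pi> u \<in> delta A"
    using run u unfolding is_run_iff by auto
qed

section \<open>Exchanging the state at a node\<close>

text \<open>At the root no context remains, since trees are nonempty; there the clause of upward trace
  inclusion on initial states takes the place of the one on runs.\<close>

lemma up_trace_incl_run_along_path: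
  assumes tree: "is_tree (alphabet A) (rank A) t" and run: "is_run A t \<pi>"
    and v: "v \<in> dom t" "\<pi> v = Some q"
    and qr: "(q, r) \<in> up_trace_incl A (Id_on (states A))"
  obtains \<pi>' where "\<pi>' v = Some r" and "ran \<pi>' \<subseteq> states A"
    and "\<And>w. prefix w v \<Longrightarrow> w \<in> dom \<pi>' \<longleftrightarrow> w \<in> dom \<pi>"
    and "the (\<pi> []) \<in> initial A \<Longrightarrow> the (\<pi>' []) \<in> initial A"
    and "\<And>u. strict_prefix u v \<Longrightarrow> transition_at A t \<pi>' u \<in> delta A"
    and "\<And>u i. \<lbrakk>strict_prefix u v; \<not> prefix (u @ [i]) v; 1 \<le> i; i \<le> rank A (the (t u))\<rbrakk>
           \<Longrightarrow> \<pi>' (u @ [i]) = \<pi> (u @ [i])"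
proof (cases "v = []")
  case True
  have "r \<in> states A" "q \<in> initial A \<longrightarrow> r \<in> initial A"
    using qr by (auto simp: up_trace_incl_def)
  \<comment> \<open>The root has no strict prefix and is its own only prefix, so a map defined at
    the root alone suffices.\<close>
  then show ?thesis
    using True v by (intro that[of "[[] \<mapsto> r]"]) auto
next
  case False
  let ?t = "t |` {w. \<not> prefix v w}" and ?\<pi> = "\<pi> |` {w. \<not> strict_prefix v w}"
  have rcut: "is_run A ?t ?\<pi>"
    by (rule is_run_cut[OF tree run v(1) False])
  have pv: "?\<pi> v = Some q"
    using v by simp
  have dl: "v \<in> dangling_leaves ?t ?\<pi>"
    unfolding dangling_leaves_def using pv by auto
  \<comment> \<open>The clause on runs is applied to the cut tree, where \<open>v\<close> is a
    dangling leaf carrying \<open>q\<close>.\<close>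
  obtain \<pi>r where \<pi>r: "is_run A ?t \<pi>r" "\<pi>r v = Some r"
    and ini: "\<And>v'. prefix v' v \<Longrightarrow> the (?\<pi> v') \<in> initial A \<Longrightarrow> the (\<pi>r v') \<in> initial A"
    and side: "\<And>v' x. strict_prefix v' v \<Longrightarrow> v' @ [x] \<in> dom ?\<pi> \<Longrightarrow> \<not> prefix (v' @ [x]) v \<Longrightarrow>
        (the (?\<pi> (v' @ [x])), the (\<pi>r (v' @ [x]))) \<in> Id_on (states A)"
  proof -
    have "\<exists>\<pi>r. is_run A ?t \<pi>r \<and> \<pi>r v = Some r \<and>
        (\<forall>v'. prefix v' v \<longrightarrow> the (?\<pi> v') \<in> initial A \<longrightarrow> the (\<pi>r v') \<in> initial A) \<and>
        (\<forall>v' x. strict_prefix v' v \<and> v' @ [x] \<in> dom ?\<pi> \<and> \<not> prefix (v' @ [x]) v \<longrightarrow>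
           (the (?\<pi> (v' @ [x])), the (\<pi>r (v' @ [x]))) \<in> Id_on (states A))"
      using qr[unfolded up_trace_incl_def, simplified mem_Collect_eq prod.case,
          THEN conjunct2, THEN conjunct2, THEN conjunct2, THEN conjunct2,
          rule_format, OF conjI[OF is_tree_cut[OF tree v(1) False] conjI[OF rcut conjI[OF dl pv]]]] .
    then show ?thesis
      using that by (elim exE conjE) simp
  qed
  have doms: "dom \<pi>r = dom ?\<pi>"
    using \<pi>r(1) rcut unfolding is_run_iff by simp
  have anc: "u \<in> dom t" "\<not> prefix v u" if "strict_prefix u v" for u
    using that is_tree_prefix_closed[OF tree v(1)] by (auto simp: strict_prefix_def)
  show ?thesis
  proof (rule that[of \<pi>r])
    show "\<pi>r v = Some r" "ran \<pi>r \<subseteq> states A"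
      using \<pi>r unfolding is_run_iff by auto
    show "w \<in> dom \<pi>r \<longleftrightarrow> w \<in> dom \<pi>" if "prefix w v" for w
      using that unfolding doms by (auto simp: strict_prefix_def)
    show "the (\<pi>r []) \<in> initial A" if "the (\<pi> []) \<in> initial A"
      using ini[of "[]"] that by simp
    show "transition_at A t \<pi>r u \<in> delta A" if "strict_prefix u v" for u
    proof -
      have "transition_at A t \<pi>r u = transition_at A ?t \<pi>r u"
        using anc[OF that] by (intro transition_at_cong) auto
      then show ?thesis
        using \<pi>r(1) anc[OF that] unfolding is_run_iff by auto
    qed
    show "\<pi>r (u @ [i]) = \<pi> (u @ [i])"
      if u: "strict_prefix u v" "\<not> prefix (u @ [i]) v" "1 \<le> i" "i \<le> rank A (the (t u))" for u i
    proof -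
      have ns: "\<not> strict_prefix v (u @ [i])"
        using anc(2)[OF u(1)] by (auto simp: strict_prefix_def)
      have "u @ [i] \<in> dom \<pi>"
        using run u anc(1)[OF u(1)] unfolding is_run_iff run_domain_def by blast
      then have d: "u @ [i] \<in> dom ?\<pi>"
        using ns by auto
      then have "u @ [i] \<in> dom \<pi>r"
        using doms by simp
      \<comment> \<open>\<open>Id_on\<close> equates only the values under \<open>the\<close>;
        membership in both domains lifts this to equality of options.\<close>
      with side[OF u(1) d u(2)] d ns show ?thesis
        by (auto simp: Id_on_def)
    qed
  qed
qed

text \<open>The run is glued together: new states on the path from the root to \<open>v\<close>, old
  states elsewhere. The children of \<open>v\<close> are off the path, so they still match the
  targets \<open>qs\<close>.\<close>

lemma up_trace_incl_exchange:
  assumes tree: "is_tree (alphabet A) (rank A) t" and run: "is_run A t \<pi>"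
    and v: "v \<in> dom t" and tr: "transition_at A t \<pi> v = (q, a, qs)"
    and qr: "(q, r) \<in> up_trace_incl A (Id_on (states A))" and r: "(r, a, qs) \<in> delta A"
  obtains \<pi>' where "is_run A t \<pi>'" and "the (\<pi>' v) = r"
    and "the (\<pi> []) \<in> initial A \<Longrightarrow> the (\<pi>' []) \<in> initial A"
    and "\<And>w. \<not> prefix w v \<Longrightarrow> \<pi>' w = \<pi> w"
proof -
  have "v \<in> dom \<pi>"
    using run v unfolding is_run_iff run_domain_def by blast
  then have "\<pi> v = Some q"
    using tr by (auto simp: transition_at_def Let_def)
  then obtain \<pi>r where \<pi>r: "\<pi>r v = Some r" "ran \<pi>r \<subseteq> states A"
      "\<And>w. prefix w v \<Longrightarrow> w \<in> dom \<pi>r \<longleftrightarrow> w \<in> dom \<pi>"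
      "the (\<pi> []) \<in> initial A \<Longrightarrow> the (\<pi>r []) \<in> initial A"
    and tr_r: "\<And>u. strict_prefix u v \<Longrightarrow> transition_at A t \<pi>r u \<in> delta A"
    and side: "\<And>u i. \<lbrakk>strict_prefix u v; \<not> prefix (u @ [i]) v; 1 \<le> i; i \<le> rank A (the (t u))\<rbrakk>
           \<Longrightarrow> \<pi>r (u @ [i]) = \<pi> (u @ [i])"
    using up_trace_incl_run_along_path[OF tree run v _ qr] by blast
  define \<pi>' where "\<pi>' w = (if prefix w v then \<pi>r w else \<pi> w)" for w
  have "is_run A t \<pi>'"
    unfolding is_run_iff
  proof (intro conjI ballI)
    have "dom \<pi>' = dom \<pi>"
      using \<pi>r(3) unfolding \<pi>'_def dom_def by auto
    then show "dom \<pi>' = run_domain A t"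
      using run unfolding is_run_iff by simp
    show "ran \<pi>' \<subseteq> states A"
      using run \<pi>r(2) unfolding is_run_iff
      by (auto simp: ran_def \<pi>'_def split: if_splits)
  next
    fix u assume u: "u \<in> dom t"
    \<comment> \<open>Off the path, the children are off the path too and the old transition
      remains. Strictly above \<open>v\<close>, both maps agree on the side children, so the
      transition is that of \<open>\<pi>r\<close>.\<close>
    consider "\<not> prefix u v" | "u = v" | "strict_prefix u v"
      by (auto simp: strict_prefix_def)
    then show "transition_at A t \<pi>' u \<in> delta A"
    proof cases
      case 1
      then have "transition_at A t \<pi>' u = transition_at A t \<pi> u"
        by (intro transition_at_cong) (auto simp: \<pi>'_def dest: append_prefixD)
      then show ?thesis
        using run u unfolding is_run_iff by simp
    next
      case 2
      have "transition_at A t \<pi>' v = (r, a, qs)"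
        using tr \<pi>r(1) by (auto simp: transition_at_def Let_def \<pi>'_def simp del: upt_Suc)
      with 2 r show ?thesis by simp
    next
      case 3
      then have "transition_at A t \<pi>' u = transition_at A t \<pi>r u"
        using side by (intro transition_at_cong) (auto simp: \<pi>'_def strict_prefix_def)
      then show ?thesis
        using tr_r[OF 3] by simp
    qed
  qed
  then show ?thesis
    using \<pi>r by (intro that[of \<pi>']) (auto simp: \<pi>'_def)
qed

section \<open>Runs of the pruned automaton\<close>

lemma Prune_simps [simp]:
  "alphabet (Prune A P) = alphabet A" "rank (Prune A P) = rank A"
  "states (Prune A P) = states A" "initial (Prune A P) = initial A" "final (Prune A P) = final A"
  "delta (Prune A P) = {\<tau> \<in> delta A. \<not> (\<exists>\<tau>' \<in> delta A. (\<tau>, \<tau>') \<in> P)}"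
  by (simp_all add: Prune_def)

lemma transition_at_Prune [simp]: "transition_at (Prune A P) = transition_at A"
  by (simp add: transition_at_def fun_eq_iff Let_def)

lemma run_domain_Prune [simp]: "run_domain (Prune A P) = run_domain A"
  by (simp add: run_domain_def fun_eq_iff)

lemma is_run_Prune_iff:
  "is_run (Prune A P) t \<pi> \<longleftrightarrow>
     is_run A t \<pi> \<and> (\<forall>v \<in> dom t. transition_at A t \<pi> v \<in> delta (Prune A P))"
  by (auto simp: is_run_iff)

lemma language_Prune_subset: "language (Prune A P) \<subseteq> language A"
  by (auto simp: language_def is_run_Prune_iff)

section \<open>Repairing a whole run\<close>

text \<open>A transitive relation is its own transitive closure, so irreflexivity excludes cycles.
  Well-foundedness of the converse provides states that are maximal for \<open>R\<close>.\<close>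

lemma wf_converse_strict_partial_order_on:
  assumes "finite X" and "strict_partial_order_on X R"
  shows "wf (R\<inverse>)"
proof (rule finite_acyclic_wf_converse)
  show "finite R"
    using assms finite_subset[of R "X \<times> X"] by (auto simp: strict_partial_order_on_def)
  have "R \<subseteq> X \<times> X" "irrefl_on X R" "trans_on X R"
    using assms(2) by (auto simp: strict_partial_order_on_def)
  then have "irrefl R" "trans R"
    unfolding irrefl_on_def trans_on_def by blast+
  then show "acyclic R"
    by (auto simp: acyclic_def irrefl_on_def)
qed

text \<open>Extremal choices replace the iteration: a maximal set \<open>F\<close> of repaired
  nodes, a deepest node \<open>v\<close> outside it, and a run whose state at \<open>v\<close> is
  maximal for \<open>R\<close>.\<close>

lemma pruned_run_exists:
  assumes "wf (R\<inverse>)" and R: "R \<subseteq> up_trace_incl A (Id_on (states A))"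
    and tree: "is_tree (alphabet A) (rank A) t"
    and "is_run A t \<pi>\<^sub>0" and "the (\<pi>\<^sub>0 []) \<in> initial A"
  obtains \<pi> where "is_run (Prune A (prune_rel_id A R)) t \<pi>" and "the (\<pi> []) \<in> initial A"
proof -
  let ?D = "delta (Prune A (prune_rel_id A R))"
  define good where "good F \<pi> \<longleftrightarrow> is_run A t \<pi> \<and> the (\<pi> []) \<in> initial A \<and>
      (\<forall>v\<in>F. transition_at A t \<pi> v \<in> ?D)" for F \<pi>
  \<comment> \<open>Closure under descendants ensures that a node outside \<open>F\<close> has no
    ancestor in \<open>F\<close>.\<close>
  define \<F> where "\<F> = {F. F \<subseteq> dom t \<and> (\<forall>v\<in>F. \<forall>w\<in>dom t. prefix v w \<longrightarrow> w \<in> F) \<and> (\<exists>\<pi>. good F \<pi>)}"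
  have fin: "finite (dom t)"
    using tree by (simp add: is_tree_def)
  then have "finite \<F>"
    by (rule finite_subset[rotated, OF finite_Pow_iff[THEN iffD2]]) (auto simp: \<F>_def)
  moreover have "{} \<in> \<F>"
    using assms(4,5) by (auto simp: \<F>_def good_def)
  ultimately obtain F where F: "F \<in> \<F>" and max: "\<And>G. G \<in> \<F> \<Longrightarrow> F \<subseteq> G \<Longrightarrow> G = F"
    using finite_has_maximal[of \<F>] by blast
  have "F = dom t"
  proof (rule ccontr)
    assume "F \<noteq> dom t"
    then have ne: "dom t - F \<noteq> {}"
      using F by (auto simp: \<F>_def)
    \<comment> \<open>With \<open>v\<close> of maximal depth outside \<open>F\<close>, all its
      proper descendants in the tree are in \<open>F\<close>.\<close>
    have "Max (length ` (dom t - F)) \<in> length ` (dom t - F)"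
      using fin ne by (intro Max_in) auto
    then obtain v where v: "v \<in> dom t" "v \<notin> F"
      and "length v = Max (length ` (dom t - F))"
      by (elim imageE) force
    then have longest: "length w \<le> length v" if "w \<in> dom t - F" for w
      using that fin by simp
    have "\<exists>q. q \<in> (\<lambda>\<pi>. the (\<pi> v)) ` Collect (good F)"
      using F by (auto simp: \<F>_def)
    \<comment> \<open>Minimal for the converse means that no run good for \<open>F\<close> has a
      state above \<open>q\<close> at \<open>v\<close>.\<close>
    then obtain q where q: "q \<in> (\<lambda>\<pi>. the (\<pi> v)) ` Collect (good F)"
      and qmin: "\<And>r. (q, r) \<in> R \<Longrightarrow> r \<notin> (\<lambda>\<pi>. the (\<pi> v)) ` Collect (good F)"
      using wfE_min[OF assms(1)] by (metis converse_iff)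
    obtain \<pi> where \<pi>: "good F \<pi>" "q = the (\<pi> v)"
      using q by auto
    obtain a qs where tr: "transition_at A t \<pi> v = (q, a, qs)"
      using \<pi>(2) by (auto simp: transition_at_def Let_def)
    have "transition_at A t \<pi> v \<in> ?D"
    proof (rule ccontr)
      assume "transition_at A t \<pi> v \<notin> ?D"
      moreover have "transition_at A t \<pi> v \<in> delta A"
        using \<pi>(1) v(1) by (auto simp: good_def is_run_iff)
      ultimately obtain r where r: "(r, a, qs) \<in> delta A" "(q, r) \<in> R"
        by (auto simp: tr prune_rel_id_def)
      obtain \<pi>' where \<pi>': "is_run A t \<pi>'" "the (\<pi>' v) = r"
          "the (\<pi> []) \<in> initial A \<Longrightarrow> the (\<pi>' []) \<in> initial A"
        and off: "\<And>w. \<not> prefix w v \<Longrightarrow> \<pi>' w = \<pi> w"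
        using up_trace_incl_exchange[OF tree _ v(1) tr _ r(1)] \<pi>(1) r(2) R
        unfolding good_def by blast
      have "transition_at A t \<pi>' w \<in> ?D" if w: "w \<in> F" for w
      proof -
        \<comment> \<open>A prefix of \<open>v\<close> in \<open>F\<close> would force
          \<open>v\<close> into \<open>F\<close>. So the exchange leaves \<open>w\<close> and its
          children alone.\<close>
        have "\<not> prefix w v"
          using F w v by (auto simp: \<F>_def)
        then have "transition_at A t \<pi>' w = transition_at A t \<pi> w"
          by (intro transition_at_cong) (auto intro!: off dest: append_prefixD)
        then show ?thesis
          using \<pi>(1) w by (auto simp: good_def)
      qed
      then have "good F \<pi>'"
        using \<pi> \<pi>' by (auto simp: good_def)
      then show False
        using qmin[OF r(2)] \<pi>'(2) by auto
    qed
    then have "good (insert v F) \<pi>"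
      using \<pi>(1) by (auto simp: good_def)
    \<comment> \<open>A proper descendant of \<open>v\<close> is longer than \<open>v\<close>, so it
      cannot lie outside \<open>F\<close>.\<close>
    moreover have "w \<in> insert v F" if "w \<in> dom t" "prefix v w" for w
      using longest[of w] that
      by (metis DiffI append_take_drop_id insertCI prefix_length_le prefix_length_prefix
          prefix_order.antisym prefix_order.order_refl)
    ultimately have "insert v F \<in> \<F>"
      using F v(1) by (auto simp: \<F>_def)
    then show False
      using max v(2) by blast
  qed
  then obtain \<pi> where "good (dom t) \<pi>"
    using F by (auto simp: \<F>_def)
  then show ?thesis
    by (intro that[of \<pi>]) (auto simp: good_def is_run_Prune_iff)
qed

theorem theorem2:
  fixes A :: "('q, 'a) automaton" and R :: "'q rel"
  assumes "tdta A"
    and "strict_partial_order_on (states A) R"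
    and "R \<subset> up_trace_incl A (Id_on (states A))"
  shows "good_for_pruning A (prune_rel_id A R)"
  unfolding good_for_pruning_def
\<comment> \<open>Pruning only removes transitions, which gives one inclusion; the other repairs an
  accepting run on the same tree.\<close>
proof (rule antisym[OF language_Prune_subset subsetI])
  fix t assume "t \<in> language A"
  then obtain \<pi> where t: "is_tree (alphabet A) (rank A) t" "closed_tree (rank A) t"
    and \<pi>: "is_run A t \<pi>" "the (\<pi> []) \<in> initial A"
    by (auto simp: language_def)
  have "wf (R\<inverse>)"
    using assms(1,2) by (auto intro: wf_converse_strict_partial_order_on simp: tdta_def)
  from pruned_run_exists[OF this _ t(1) \<pi>] assms(3)
  obtain \<pi>' where "is_run (Prune A (prune_rel_id A R)) t \<pi>'" "the (\<pi>' []) \<in> initial A"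
    by blast
  with t show "t \<in> language (Prune A (prune_rel_id A R))"
    by (auto simp: language_def)
qed

end
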